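(* Let $(T,d)$ be a metric space, $m$ a Borel probability measure on $T$ with $\operatorname{supp}(m)=T$, $p\ge 1$ and $q=\frac{p}{p-1}$. Suppose that $m$ is a majorizing measure on $T$ with respect to $\varphi_p(x)=x^p$, i.e. $$\mathcal{S}:=\sup_{x\in T}\int_0^{D(T)}\left(\frac{1}{m(B(x,\varepsilon))}\right)^{1/p}d\varepsilon<\infty.$$ Then there exists a probability measure $\nu$ on $T\times T$ such that for all continuous functions $f:T\to\mathbb{R}$, $$\sup_{s,t\in T}|f(s)-f(t)|^p\le(2K_p)^p\int_{T\times T}\left(\frac{|f(u)-f(v)|}{d(u,v)}\right)^p\nu(du,dv),$$ where $K_p=2\left(\frac{3p-1}{p}\right)\left(3q-\frac{q}{p}\right)^{1/(2q)}\mathcal{S}$.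
   Context: $B(x,\varepsilon)=\{y\in T:d(x,y)\le\varepsilon\}$ is the closed ball and $D(T)=\sup\{d(s,t):s,t\in T\}$ the diameter of $T$. The convention $0/0=0$ is used (so the integrand is $0$ on the diagonal $u=v$). For $p=1$ one has $q=\infty$ and the factor $\left(3q-\frac{q}{p}\right)^{1/(2q)}$ is read as its limit $1$, so $K_1=4\mathcal{S}$. *)

theory Defs
  imports "HOL-Probability.Probability"
begin

definition measure_support :: "'a::topological_space measure \<Rightarrow> 'a set" where
  "measure_support m = {x. \<forall>U. open U \<and> x \<in> U \<longrightarrow> 0 < emeasure m U}"

(* The library's "diameter" is real-valued and has no meaningful value on unbounded sets. *)
definition ediam :: "'a::metric_space itself \<Rightarrow> ennreal" where
  "ediam _ = (SUP s::'a. SUP t::'a. ennreal (dist s t))"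

(* (1 / m(B))^(1/p), equal to infinity (and not 1 / 0 = 0) when m(B) = 0. *)
definition inv_measure_root :: "real \<Rightarrow> 'a measure \<Rightarrow> 'a set \<Rightarrow> ennreal" where
  "inv_measure_root p m B =
     (if measure m B = 0 then \<infinity> else ennreal ((1 / measure m B) powr (1 / p)))"

definition majorizing_sup :: "real \<Rightarrow> 'a::metric_space measure \<Rightarrow> ennreal" where
  "majorizing_sup p m =
     (SUP x. \<integral>\<^sup>+ \<epsilon> \<in> {\<epsilon>. 0 \<le> \<epsilon> \<and> ennreal \<epsilon> \<le> ediam TYPE('a)}.
        inv_measure_root p m (cball x \<epsilon>) \<partial>lborel)"

(* For p = 1 the conjugate exponent q is infinite, and (3q - q/p)^(1/(2q)) is read as its limit 1. *)
definition conj_factor :: "real \<Rightarrow> real" where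
  "conj_factor p =
     (if p = 1 then 1 else let q = p / (p - 1) in (3 * q - q / p) powr (1 / (2 * q)))"

definition K_const :: "real \<Rightarrow> real \<Rightarrow> real" where
  "K_const p S = 2 * ((3 * p - 1) / p) * conj_factor p * S"

end

theory Submission
  imports Defs
begin

text \<open>
  For \<open>R > 1\<close> let \<open>r k x\<close> be the least radius for which the closed ball around \<open>x\<close> has measure at
  least \<open>R\<close> to the power \<open>- k p\<close>, and let \<open>avg f k x\<close> be the mean of \<open>f\<close> over that ball. Summation by parts in
  the majorizing integral gives \<open>\<Sum>k. R ^ k * r k x \<le> R / (R - 1) * S\<close>, so the weights
  \<open>R ^ k * r k u\<close>, combined with a uniformly distributed \<open>v\<close> in the ball around \<open>u\<close>, define a finite measure
  on the product, whose normalisation is \<open>\<nu>\<close>. Since \<open>avg f 0\<close> is constant and \<open>avg f n\<close> tends to \<open>f\<close>, it suffices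
  to bound \<open>avg f n x - avg f 0 x\<close> uniformly. Writing the increment from \<open>n\<close> to \<open>n + 1\<close> as the mean of
  \<open>f - avg f n\<close> over the smaller ball, one applies Young's inequality with the scale \<open>\<tau> * R ^ (n + 1)\<close>: the
  terms with the \<open>p\<close>-th power of the difference quotient add up to the integral over \<open>\<nu>\<close>, because averaging over a
  ball of rank \<open>n + 1\<close> costs at most the factor \<open>R\<close> to the power \<open>(n + 1) p\<close>, and the remaining terms are
  absorbed by the potential \<open>Z\<close>, because \<open>r k\<close> is 1-Lipschitz. Unbounded \<open>f\<close> are truncated.
\<close>

subsection \<open>Young's inequality and the constants\<close>

lemma le_Young_powr:
  fixes h \<tau> p :: real
  assumes "0 \<le> h" "0 < \<tau>" "1 \<le> p"
  shows "h \<le> 1 / p * (h powr p * \<tau> powr (1 - p)) + (1 - 1 / p) * \<tau>"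
proof (cases "h = 0")
  case True
  with assms show ?thesis by simp
next
  case False
  with assms have h: "h > 0" by simp
  let ?a = "h powr p * \<tau> powr (1 - p)"
  have "?a powr (1 / p) * \<tau> powr (1 - 1 / p) = h powr (p * (1 / p)) * \<tau> powr ((1 - p) * (1 / p) + (1 - 1 / p))"
    using h assms(2) by (simp only: powr_mult powr_powr powr_ge_zero powr_add mult.assoc)
  also have "\<dots> = h"
    using h assms by (simp add: diff_divide_distrib)
  finally have "h = ?a powr (1 / p) * \<tau> powr (1 - 1 / p)" ..
  also have "\<dots> \<le> 1 / p * ?a + (1 - 1 / p) * \<tau>"
    by (rule Youngs_inequality_0) (use h assms in auto)
  finally show ?thesis .
qed

lemma conj_factor_pos:
  assumes "1 \<le> p"
  shows "0 < conj_factor p"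
proof (cases "p = 1")
  case False
  with assms have "1 < p" by simp
  define q where "q = p / (p - 1)"
  have "0 < q" using \<open>1 < p\<close> by (simp add: q_def)
  then have "q / p < 3 * q" using \<open>1 < p\<close> by (simp add: field_simps)
  then show ?thesis using False by (simp add: conj_factor_def Let_def flip: q_def)
qed (simp add: conj_factor_def)

text \<open>
  With \<open>\<delta> = 1 - 1 / p\<close>, \<open>a = 2 + \<delta> = (3 p - 1) / p\<close> and \<open>s\<^sup>2 = \<delta> / a\<close>, the factor \<^term>\<open>conj_factor p\<close>
  is \<open>s powr - \<delta>\<close> for \<open>p > 1\<close>. Choosing \<open>R\<close> with \<open>R - 2 = s (R - 1)\<close> makes the constraint an equality for
  \<open>c = a s\<close>, and \<open>\<tau>\<close> minimises the left-hand side.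
\<close>

lemma chaining_parameters:
  fixes p :: real
  assumes p: "1 \<le> p"
  obtains R c where "2 \<le> R" "0 \<le> c" "(1 - 1 / p) * (R - 1) \<le> c * (R - 2)"
    "\<And>H. 0 < H \<Longrightarrow> \<exists>\<tau>>0. R * (R / (R - 1)) * (1 / p * \<tau> powr (1 - p) * H + c * \<tau>)
       \<le> 2 * ((3 * p - 1) / p) * conj_factor p * H powr (1 / p)"
proof -
  define \<delta> where "\<delta> = 1 - 1 / p"
  define a where "a = 2 + \<delta>"
  define s where "s = sqrt (\<delta> / a)"
  define R where "R = (2 - s) / (1 - s)"
  have \<delta>: "0 \<le> \<delta>" "\<delta> < 1" using p by (auto simp: \<delta>_def)
  have a: "2 \<le> a" using \<delta> by (simp add: a_def)
  have a_eq: "(3 * p - 1) / p = a" using p by (simp add: a_def \<delta>_def field_simps)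
  have "\<delta> / a < 1" using \<delta> a by simp
  then have s: "0 \<le> s" "s < 1" using \<delta> a by (auto simp: s_def)
  have "s\<^sup>2 = \<delta> / a" using \<delta> a by (simp add: s_def)
  then have as: "a * s\<^sup>2 = \<delta>" using a by simp
  have R: "2 \<le> R" using s by (simp add: R_def field_simps)
  have R1: "R - 1 = 1 / (1 - s)" and R2: "R - 2 = s / (1 - s)"
    using s by (auto simp: R_def field_simps)
  have c: "\<delta> * (R - 1) \<le> (a * s) * (R - 2)"
    unfolding R1 R2 as[symmetric] by (simp add: power2_eq_square)
  have RR: "R * (R / (R - 1)) \<le> 2 * a"
  proof -
    have "s ^ 3 \<le> 3 * s\<^sup>2"
      using s mult_right_mono[of s 3 "s\<^sup>2"] by (simp add: power3_eq_cube power2_eq_square)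
    then have "(2 - s)\<^sup>2 * (1 + s) \<le> 4"
      by (simp add: power2_eq_square power3_eq_cube algebra_simps)
    also have "4 = 2 * (a - \<delta>)" by (simp add: a_def)
    also have "\<dots> = 2 * a * (1 - s) * (1 + s)"
      unfolding as[symmetric] by (simp add: power2_eq_square algebra_simps)
    finally have "(2 - s)\<^sup>2 \<le> 2 * a * (1 - s)" using s by simp
    then have "(2 - s)\<^sup>2 / (1 - s) \<le> 2 * a" using s by (simp only: pos_divide_le_eq diff_gt_0_iff_gt)
    moreover have "R * (R / (R - 1)) = (2 - s)\<^sup>2 / (1 - s)"
    proof -
      have "R / (R - 1) = 2 - s" unfolding R1 using s by (simp add: R_def)
      then show ?thesis by (simp add: R_def power2_eq_square)
    qed
    ultimately show ?thesis by simp
  qed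
  have "\<exists>\<tau>>0. R * (R / (R - 1)) * (1 / p * \<tau> powr (1 - p) * H + (a * s) * \<tau>)
       \<le> 2 * ((3 * p - 1) / p) * conj_factor p * H powr (1 / p)" if H: "0 < H" for H
  proof -
    have "\<exists>\<tau>>0. 1 / p * \<tau> powr (1 - p) * H + (a * s) * \<tau> \<le> conj_factor p * H powr (1 / p)"
    proof (cases "p = 1")
      case True
      then have "s = 0" by (simp add: s_def \<delta>_def)
      with True H show ?thesis by (intro exI[of _ 1]) (simp add: conj_factor_def)
    next
      case False
      with p have p1: "1 < p" by simp
      then have "0 < \<delta>" by (simp add: \<delta>_def)
      then have s0: "0 < s" using a by (simp add: s_def)
      define \<tau> where "\<tau> = (s * H) powr (1 / p)"
      have "1 / p * \<tau> powr (1 - p) * H = (1 - \<delta>) * (s powr (- \<delta>) * H powr (1 / p))"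
      proof -
        have "\<tau> powr (1 - p) = (s * H) powr (- \<delta>)"
          unfolding \<tau>_def \<delta>_def using p1 by (simp add: powr_powr diff_divide_distrib)
        also have "\<dots> = s powr (- \<delta>) * H powr (- \<delta>)"
          using s0 H by (simp add: powr_mult)
        finally have "1 / p * \<tau> powr (1 - p) * H = (1 - \<delta>) * (s powr (- \<delta>) * (H powr (- \<delta>) * H powr 1))"
          using H by (simp add: \<delta>_def)
        also have "H powr (- \<delta>) * H powr 1 = H powr (1 / p)"
          unfolding powr_add[symmetric] by (simp add: \<delta>_def)
        finally show ?thesis .
      qed
      moreover have "(a * s) * \<tau> = \<delta> * (s powr (- \<delta>) * H powr (1 / p))"
      proof -
        have "s powr (1 / p) = s powr (- \<delta>) * s powr 1"
          unfolding powr_add[symmetric] by (simp add: \<delta>_def)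
        then have "\<tau> = s powr (- \<delta>) * s * H powr (1 / p)"
          using s0 H by (simp add: \<tau>_def powr_mult)
        then show ?thesis
          unfolding as[symmetric] by (simp add: power2_eq_square)
      qed
      ultimately have "1 / p * \<tau> powr (1 - p) * H + (a * s) * \<tau> = s powr (- \<delta>) * H powr (1 / p)"
        by (simp add: algebra_simps)
      moreover have "conj_factor p = s powr (- \<delta>)"
      proof -
        define q where "q = p / (p - 1)"
        have q: "q = 1 / \<delta>" using p1 by (simp add: q_def \<delta>_def field_simps)
        have "3 * q - q / p = (3 - 1 / p) * q" by (simp add: algebra_simps)
        also have "\<dots> = a / \<delta>" by (simp add: q a_def \<delta>_def)
        also have "\<dots> = 1 / s\<^sup>2"
          using \<open>0 < \<delta>\<close> a by (simp add: s_def)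
        also have "\<dots> = s powr (- 2)"
          using s0 by (simp add: powr_minus_divide)
        finally have "conj_factor p = (s powr (- 2)) powr (1 / (2 * q))"
          using False by (simp add: conj_factor_def Let_def flip: q_def)
        also have "\<dots> = s powr (- \<delta>)"
          unfolding powr_powr q by simp
        finally show ?thesis .
      qed
      moreover have "0 < \<tau>" using s0 H by (simp add: \<tau>_def)
      ultimately show ?thesis by (intro exI[of _ \<tau>]) simp
    qed
    then obtain \<tau> where \<tau>: "0 < \<tau>"
      "1 / p * \<tau> powr (1 - p) * H + (a * s) * \<tau> \<le> conj_factor p * H powr (1 / p)" by blast
    have "R * (R / (R - 1)) * (1 / p * \<tau> powr (1 - p) * H + (a * s) * \<tau>) \<le>
        2 * a * (conj_factor p * H powr (1 / p))"
      by (rule mult_mono[OF RR \<tau>(2)]) (use \<tau>(1) a R s p H in auto)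
    then show ?thesis using \<tau>(1) unfolding a_eq by (auto simp: mult_ac)
  qed
  then show thesis
    using that[of R "a * s"] R c a s by (simp add: \<delta>_def)
qed

subsection \<open>Radii of balls of prescribed measure\<close>

lemma sets_borel_prod_separable:
  fixes Q :: "'a::metric_space set"
  assumes Q: "countable Q" "\<And>x e. 0 < e \<Longrightarrow> \<exists>q\<in>Q. dist q x < e"
  shows "sets (borel \<Otimes>\<^sub>M borel) = sets (borel :: ('a \<times> 'a) measure)"
proof
  show "sets (borel \<Otimes>\<^sub>M borel) \<subseteq> sets (borel :: ('a \<times> 'a) measure)"
  proof
    fix A :: "('a \<times> 'a) set" assume A: "A \<in> sets (borel \<Otimes>\<^sub>M borel)"
    have "(\<lambda>z. z) \<in> (borel :: ('a \<times> 'a) measure) \<rightarrow>\<^sub>M borel \<Otimes>\<^sub>M borel"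
      by (intro measurable_pair borel_measurable_continuous_onI) (simp_all add: comp_def continuous_on_fst continuous_on_snd continuous_on_id)
    from measurable_sets[OF this A] show "A \<in> sets borel" by simp
  qed
  have "U \<in> sets (borel \<Otimes>\<^sub>M borel)" if U: "open U" for U :: "('a \<times> 'a) set"
  proof -
    define b where "b = (\<lambda>(q, r, n). ball q (1 / real (Suc n)) \<times> ball r (1 / real (Suc n)) :: ('a \<times> 'a) set)"
    define I where "I = {i \<in> Q \<times> Q \<times> UNIV. b i \<subseteq> U}"
    have "countable I"
      unfolding I_def using Q(1) by (intro countable_Collect countable_SIGMA) auto
    moreover have "b i \<in> sets (borel \<Otimes>\<^sub>M borel)" for i
      by (auto simp: b_def split: prod.split intro!: pair_measureI)
    moreover have "U = (\<Union>i\<in>I. b i)"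
    proof
      show "U \<subseteq> (\<Union>i\<in>I. b i)"
      proof
        fix z assume "z \<in> U"
        then obtain A B where AB: "open A" "open B" "z \<in> A \<times> B" "A \<times> B \<subseteq> U"
          using U by (metis open_prod_def)
        then obtain x y where z: "z = (x, y)" "x \<in> A" "y \<in> B" by auto
        obtain d e where de: "d > 0" "ball x d \<subseteq> A" "e > 0" "ball y e \<subseteq> B"
          using AB z by (meson open_contains_ball)
        obtain n where "inverse (real (Suc n)) < min d e / 2"
          using de by (metis half_gt_zero min_less_iff_conj reals_Archimedean)
        then have n: "1 / Suc n < d / 2" "1 / Suc n < e / 2"
          by (auto simp: inverse_eq_divide)
        obtain q r where qr: "q \<in> Q" "dist q x < 1 / Suc n" "r \<in> Q" "dist r y < 1 / Suc n"
          using Q(2)[of "1 / Suc n"] by (metis of_nat_0_less_iff zero_less_Suc zero_less_divide_1_iff)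
        have "ball q (1 / Suc n) \<subseteq> ball x d"
        proof
          fix w assume "w \<in> ball q (1 / Suc n)"
          then have "dist x w < d"
            using dist_triangle[of x w q] qr(2) n by (simp add: dist_commute del: of_nat_Suc)
          then show "w \<in> ball x d" by simp
        qed
        moreover have "ball r (1 / Suc n) \<subseteq> ball y e"
        proof
          fix w assume "w \<in> ball r (1 / Suc n)"
          then have "dist y w < e"
            using dist_triangle[of y w r] qr(4) n by (simp add: dist_commute del: of_nat_Suc)
          then show "w \<in> ball y e" by simp
        qed
        ultimately have "b (q, r, n) \<subseteq> A \<times> B"
          unfolding b_def using de by (simp add: Sigma_mono subset_trans del: of_nat_Suc)
        then have "(q, r, n) \<in> I"
          unfolding I_def using AB(4) qr by auto
        moreover have "z \<in> b (q, r, n)"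
          using qr z by (simp add: b_def)
        ultimately show "z \<in> (\<Union>i\<in>I. b i)" by blast
      qed
    qed (auto simp: I_def)
    ultimately show ?thesis by (metis sets.countable_UN'')
  qed
  then show "sets (borel :: ('a \<times> 'a) measure) \<subseteq> sets (borel \<Otimes>\<^sub>M borel)"
    using sets.sigma_sets_subset[of "{S. open S}" "borel \<Otimes>\<^sub>M borel :: ('a \<times> 'a) measure"]
    by (auto simp: borel_def space_pair_measure)
qed

locale majorizing_chain = prob_space m for m :: "'a::metric_space measure" +
  fixes p R S :: real
  assumes sets_m [measurable_cong, simp]: "sets m = sets borel"
    and support: "measure_support m = UNIV"
    and p: "1 \<le> p"
    and R: "2 \<le> R"
    and S: "0 \<le> S" "majorizing_sup p m = ennreal S"
begin

lemma space_m [simp]: "space m = UNIV"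
  using sets_eq_imp_space_eq[OF sets_m] by simp

lemma cball_sets [measurable, simp]: "cball x \<epsilon> \<in> sets m"
  by simp

lemma inv_measure_root_ge:
  assumes "0 < a" "measure m B \<le> (1 / a) powr p"
  shows "ennreal a \<le> inv_measure_root p m B"
proof (cases "measure m B = 0")
  case False
  then have B: "0 < measure m B" by (simp add: zero_less_measure_iff)
  have "a = ((1 / (1 / a) powr p)) powr (1 / p)"
    using p assms(1) by (simp add: powr_divide powr_powr)
  also have "\<dots> \<le> (1 / measure m B) powr (1 / p)"
    using p assms B by (intro powr_mono2 divide_left_mono mult_pos_pos) auto
  finally show ?thesis
    using False by (simp add: inv_measure_root_def ennreal_leI)
qed (simp add: inv_measure_root_def)

lemma majorizing_integral_le:
  "(\<integral>\<^sup>+ \<epsilon> \<in> {\<epsilon>. 0 \<le> \<epsilon> \<and> ennreal \<epsilon> \<le> ediam TYPE('a)}. inv_measure_root p m (cball x \<epsilon>) \<partial>lborel) \<le> ennreal S"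
  unfolding S(2)[symmetric] majorizing_sup_def by (rule SUP_upper) simp

lemma le_S_if_le_ediam:
  assumes "0 \<le> e" "ennreal e \<le> ediam TYPE('a)"
  shows "e \<le> S"
proof -
  have "ennreal e = (\<integral>\<^sup>+ \<epsilon>. indicator {0..e} \<epsilon> \<partial>lborel)"
    using assms by simp
  also have "\<dots> \<le> (\<integral>\<^sup>+ \<epsilon> \<in> {\<epsilon>. 0 \<le> \<epsilon> \<and> ennreal \<epsilon> \<le> ediam TYPE('a)}.
      inv_measure_root p m (cball undefined \<epsilon>) \<partial>lborel)"
  proof (rule nn_integral_mono)
    fix \<epsilon> :: real
    have "1 \<le> inv_measure_root p m (cball undefined \<epsilon>)"
      using inv_measure_root_ge[of 1] by simp
    moreover have "ennreal \<epsilon> \<le> ediam TYPE('a)" if "\<epsilon> \<le> e"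
      using assms(2) that by (meson ennreal_leI order_trans)
    ultimately show "indicator {0..e} \<epsilon> \<le> inv_measure_root p m (cball undefined \<epsilon>) *
        indicator {\<epsilon>. 0 \<le> \<epsilon> \<and> ennreal \<epsilon> \<le> ediam TYPE('a)} \<epsilon>"
      by (auto split: split_indicator)
  qed
  also have "\<dots> \<le> ennreal S" by (rule majorizing_integral_le)
  finally show ?thesis using S by simp
qed

definition D :: real where "D = enn2real (ediam TYPE('a))"

lemma ediam_eq: "ediam TYPE('a) = ennreal D"
proof -
  have "ediam TYPE('a) \<noteq> \<top>"
    using le_S_if_le_ediam[of "S + 1"] S by auto
  then show ?thesis by (simp add: D_def less_top)
qed

lemma D_nonneg: "0 \<le> D"
  by (simp add: D_def)

lemma dist_le_D: "dist (s :: 'a) t \<le> D"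
proof -
  have "ennreal (dist s t) \<le> ediam TYPE('a)"
    unfolding ediam_def by (intro SUP_upper2[of s] SUP_upper2[of t]) auto
  then show ?thesis by (simp add: ediam_eq D_nonneg)
qed

definition \<theta> :: "nat \<Rightarrow> real" where "\<theta> k = (1 / R ^ k) powr p"

lemma \<theta>_pos: "0 < \<theta> k"
  using R by (simp add: \<theta>_def)

lemma \<theta>_le_1: "\<theta> k \<le> 1"
  using R p by (auto simp: \<theta>_def intro!: powr_le1 one_le_power)

definition r :: "nat \<Rightarrow> 'a \<Rightarrow> real" where
  "r k x = Inf {\<epsilon>. 0 \<le> \<epsilon> \<and> \<theta> k \<le> measure m (cball x \<epsilon>)}"

lemma r_le:
  assumes "0 \<le> \<epsilon>" "\<theta> k \<le> measure m (cball x \<epsilon>)"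
  shows "r k x \<le> \<epsilon>"
  unfolding r_def using assms by (intro cInf_lower bdd_belowI[of _ 0]) auto

lemma D_in_r_set: "D \<in> {\<epsilon>. 0 \<le> \<epsilon> \<and> \<theta> k \<le> measure m (cball x \<epsilon>)}"
proof -
  have "cball x D = space m" by (auto simp: dist_le_D)
  then show ?thesis using D_nonneg \<theta>_le_1 by (simp add: prob_space del: space_m)
qed

lemma r_nonneg [simp]: "0 \<le> r k x"
  unfolding r_def using D_in_r_set by (intro cInf_greatest) auto

lemma r_le_D: "r k x \<le> D"
  using D_in_r_set by (intro r_le) auto

lemma \<theta>_le_measure: "\<theta> k \<le> measure m (cball x (r k x))"
proof -
  let ?A = "\<lambda>n. cball x (r k x + 1 / Suc n)"
  have "\<theta> k \<le> measure m (?A n)" for n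
  proof -
    have "Inf {\<epsilon>. 0 \<le> \<epsilon> \<and> \<theta> k \<le> measure m (cball x \<epsilon>)} < r k x + 1 / Suc n"
      unfolding r_def[symmetric] by simp
    from cInf_lessD[OF _ this] D_in_r_set obtain \<epsilon>
      where "\<theta> k \<le> measure m (cball x \<epsilon>)" "\<epsilon> < r k x + 1 / Suc n" by blast
    moreover have "measure m (cball x \<epsilon>) \<le> measure m (?A n)"
      using \<open>\<epsilon> < _\<close> by (intro finite_measure_mono) auto
    ultimately show ?thesis by linarith
  qed
  moreover have "(\<lambda>n. measure m (?A n)) \<longlonglongrightarrow> measure m (\<Inter>n. ?A n)"
  proof (intro finite_Lim_measure_decseq)
    show "decseq ?A"
      unfolding decseq_def
    proof (intro allI impI subset_cball add_left_mono)
      fix i j :: nat assume "i \<le> j"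
      then show "1 / real (Suc j) \<le> 1 / real (Suc i)" by (intro divide_left_mono) auto
    qed
  qed auto
  moreover have "(\<Inter>n. ?A n) = cball x (r k x)"
  proof -
    have "(\<lambda>n. r k x + 1 / Suc n) \<longlonglongrightarrow> r k x + 0"
      by (intro tendsto_add tendsto_const LIMSEQ_Suc[OF lim_1_over_n])
    then have "dist x y \<le> r k x" if "\<forall>n. dist x y \<le> r k x + 1 / Suc n" for y
      using that by (intro LIMSEQ_le_const) auto
    moreover have "dist x y \<le> r k x + 1 / Suc n" if "dist x y \<le> r k x" for y n
      using that by (simp add: add_increasing2)
    ultimately show ?thesis by (auto simp del: of_nat_Suc)
  qed
  ultimately have "(\<lambda>n. measure m (?A n)) \<longlonglongrightarrow> measure m (cball x (r k x))" by simp
  then show ?thesis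
    by (rule LIMSEQ_le_const) (use \<open>\<And>n. \<theta> k \<le> measure m (?A n)\<close> in blast)
qed

lemma measure_less_\<theta>:
  assumes "0 \<le> \<epsilon>" "\<epsilon> < r k x"
  shows "measure m (cball x \<epsilon>) < \<theta> k"
  using r_le[of \<epsilon> k x] assms by linarith

lemma measure_ball_pos: "0 < measure m (cball x (r k x))"
  using \<theta>_le_measure \<theta>_pos by (rule less_le_trans[rotated])

lemma r_lipschitz: "r k x \<le> r k y + dist x y"
proof (rule r_le)
  have "cball y (r k y) \<subseteq> cball x (r k y + dist x y)"
  proof
    fix z assume "z \<in> cball y (r k y)"
    then show "z \<in> cball x (r k y + dist x y)"
      using dist_triangle[of x z y] by simp
  qed
  then have "measure m (cball y (r k y)) \<le> measure m (cball x (r k y + dist x y))"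
    by (intro finite_measure_mono) auto
  with \<theta>_le_measure[of k y] show "\<theta> k \<le> measure m (cball x (r k y + dist x y))" by linarith
qed simp

lemma sum_r_le: "(\<Sum>k\<le>n. R ^ k * r k x) \<le> R / (R - 1) * S"
proof -
  define c where "c k = R ^ k * (1 - 1 / R)" for k
  have c_nonneg: "0 \<le> c k" for k using R by (simp add: c_def)
  have sum_c: "(\<Sum>k\<le>j. c k) \<le> R ^ j" for j
  proof -
    have "(\<Sum>k\<le>j. c k) = R ^ j - 1 / R"
      unfolding c_def using R by (induction j) (auto simp: field_simps)
    then show ?thesis using R by simp
  qed
  have "ennreal (\<Sum>k\<le>n. c k * r k x) = (\<integral>\<^sup>+ \<epsilon>. (\<Sum>k\<le>n. ennreal (c k) * indicator {0..<r k x} \<epsilon>) \<partial>lborel)"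
    by (subst nn_integral_sum)
      (auto simp: nn_integral_cmult c_nonneg ennreal_mult simp flip: sum_ennreal)
  also have "\<dots> \<le> (\<integral>\<^sup>+ \<epsilon> \<in> {\<epsilon>. 0 \<le> \<epsilon> \<and> ennreal \<epsilon> \<le> ediam TYPE('a)}.
      inv_measure_root p m (cball x \<epsilon>) \<partial>lborel)"
  proof (rule nn_integral_mono)
    fix \<epsilon> :: real
    define A where "A = {k. k \<le> n \<and> 0 \<le> \<epsilon> \<and> \<epsilon> < r k x}"
    have A: "finite A" unfolding A_def by (rule finite_subset[of _ "{..n}"]) auto
    have eq: "(\<Sum>k\<le>n. ennreal (c k) * indicator {0..<r k x} \<epsilon>) = (\<Sum>k\<in>A. ennreal (c k))"
      by (rule sum.mono_neutral_cong_right) (auto simp: A_def)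
    show "(\<Sum>k\<le>n. ennreal (c k) * indicator {0..<r k x} \<epsilon>)
      \<le> inv_measure_root p m (cball x \<epsilon>) * indicator {\<epsilon>. 0 \<le> \<epsilon> \<and> ennreal \<epsilon> \<le> ediam TYPE('a)} \<epsilon>"
    proof (cases "A = {}")
      case False
      define j where "j = Max A"
      have "j \<in> A" using A False by (simp add: j_def)
      have j: "0 \<le> \<epsilon>" "\<epsilon> < r j x" using \<open>j \<in> A\<close> by (auto simp: A_def)
      have "(\<Sum>k\<in>A. c k) \<le> (\<Sum>k\<le>j. c k)"
        using A by (intro sum_mono2) (auto simp: j_def c_nonneg)
      also have "\<dots> \<le> R ^ j" by (rule sum_c)
      finally have "(\<Sum>k\<in>A. ennreal (c k)) \<le> ennreal (R ^ j)"
        by (subst sum_ennreal) (auto simp: c_nonneg ennreal_leI)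
      also have "\<dots> \<le> inv_measure_root p m (cball x \<epsilon>)"
        using R measure_less_\<theta>[OF j] by (intro inv_measure_root_ge) (auto simp: \<theta>_def)
      finally show ?thesis
        using j r_le_D[of j x] by (simp add: eq ediam_eq D_nonneg)
    qed (simp add: eq)
  qed
  also have "\<dots> \<le> ennreal S" by (rule majorizing_integral_le)
  finally have "(\<Sum>k\<le>n. c k * r k x) \<le> S" using S by simp
  moreover have "(\<Sum>k\<le>n. c k * r k x) = (1 - 1 / R) * (\<Sum>k\<le>n. R ^ k * r k x)"
    by (simp add: c_def sum_distrib_left mult_ac)
  ultimately show ?thesis using R by (simp add: field_simps)
qed

definition \<rho> :: "nat \<Rightarrow> real" where "\<rho> k = R / (R - 1) * S / R ^ k"

lemma r_le_\<rho>: "r k x \<le> \<rho> k"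
proof -
  have "R ^ k * r k x \<le> (\<Sum>k\<le>k. R ^ k * r k x)"
    using R by (intro member_le_sum) auto
  also have "\<dots> \<le> R / (R - 1) * S" by (rule sum_r_le)
  finally show ?thesis using R by (simp add: \<rho>_def field_simps)
qed

lemma \<rho>_tendsto_0: "\<rho> \<longlonglongrightarrow> 0"
  unfolding \<rho>_def using R by (intro LIMSEQ_divide_realpow_zero) auto

lemma r_tendsto_0: "(\<lambda>k. r k x) \<longlonglongrightarrow> 0"
proof (rule tendsto_sandwich[OF _ _ tendsto_const \<rho>_tendsto_0])
  show "\<forall>\<^sub>F k in sequentially. r k x \<le> \<rho> k" by (simp add: r_le_\<rho>)
qed simp

lemma finite_net: "\<exists>F :: 'a set. finite F \<and> (\<forall>x. \<exists>y\<in>F. dist y x \<le> 2 * \<rho> k)"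
proof -
  define sep where "sep F \<longleftrightarrow> finite F \<and> (\<forall>x\<in>F. \<forall>y\<in>F. x \<noteq> y \<longrightarrow> 2 * \<rho> k < dist x y)" for F :: "'a set"
  have big: "\<theta> k \<le> measure m (cball x (\<rho> k))" for x
  proof -
    have "measure m (cball x (r k x)) \<le> measure m (cball x (\<rho> k))"
      by (intro finite_measure_mono subset_cball r_le_\<rho>) auto
    with \<theta>_le_measure[of k x] show ?thesis by linarith
  qed
  have card: "real (card F) * \<theta> k \<le> 1" if "sep F" for F
  proof -
    have "disjoint_family_on (\<lambda>x. cball x (\<rho> k)) F"
      unfolding disjoint_family_on_def
    proof (safe, rule ccontr)
      fix x y z assume "x \<in> F" "y \<in> F" "x \<noteq> y" "z \<in> cball x (\<rho> k)" "z \<in> cball y (\<rho> k)"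
      then show False
        using that dist_triangle2[of x y z] by (fastforce simp: sep_def)
    qed
    then have "(\<Sum>x\<in>F. measure m (cball x (\<rho> k))) = measure m (\<Union>x\<in>F. cball x (\<rho> k))"
      using that by (intro finite_measure_finite_Union[symmetric]) (auto simp: sep_def)
    also have "\<dots> \<le> 1" by simp
    finally show ?thesis
      using sum_mono[of F "\<lambda>_. \<theta> k" "\<lambda>x. measure m (cball x (\<rho> k))"] big by simp
  qed
  have "sep {}" by (simp add: sep_def)
  moreover have "\<forall>F. sep F \<longrightarrow> card F \<le> nat \<lceil>1 / \<theta> k\<rceil>"
  proof safe
    fix F assume "sep F"
    then have "real (card F) \<le> 1 / \<theta> k" using card \<theta>_pos[of k] by (simp add: field_simps)
    then show "card F \<le> nat \<lceil>1 / \<theta> k\<rceil>" by linarith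
  qed
  ultimately obtain F where F: "sep F" "\<And>G. sep G \<Longrightarrow> card G \<le> card F"
    using ex_has_greatest_nat[of sep "{}" card "nat \<lceil>1 / \<theta> k\<rceil> + 1"] by (metis le_imp_less_Suc Suc_eq_plus1)
  have "\<exists>y\<in>F. dist y x \<le> 2 * \<rho> k" for x
  proof (rule ccontr)
    assume *: "\<not> ?thesis"
    then have "sep (insert x F)" using F(1) by (auto simp: sep_def dist_commute)
    moreover have "0 \<le> \<rho> k" using R S by (simp add: \<rho>_def)
    then have "x \<notin> F" using * by force
    ultimately show False using F(2)[of "insert x F"] F(1) by (simp add: sep_def)
  qed
  moreover have "finite F" using F(1) by (simp add: sep_def)
  ultimately show ?thesis by metis
qed

lemma sets_borel_pair: "sets (borel :: ('a \<times> 'a) measure) = sets (borel \<Otimes>\<^sub>M borel)"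
proof -
  obtain F :: "nat \<Rightarrow> 'a set" where F: "\<And>k. finite (F k)"
      "\<And>k x. \<exists>y\<in>F k. dist y x \<le> 2 * \<rho> k"
    using finite_net by metis
  show ?thesis
  proof (rule sets_borel_prod_separable[symmetric])
    show "countable (\<Union>k. F k)" using F(1) by (auto intro: countable_finite)
    fix x :: 'a and e :: real assume "0 < e"
    have "(\<lambda>k. 2 * \<rho> k) \<longlonglongrightarrow> 2 * 0"
      by (intro tendsto_mult tendsto_const \<rho>_tendsto_0)
    then have "\<forall>\<^sub>F k in sequentially. 2 * \<rho> k < e"
      using \<open>0 < e\<close> by (intro order_tendstoD) auto
    then obtain k where "2 * \<rho> k < e"
      using eventually_happens' sequentially_bot by blast
    moreover obtain q where "q \<in> F k" "dist q x \<le> 2 * \<rho> k" using F(2) by blast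
    ultimately show "\<exists>q\<in>(\<Union>k. F k). dist q x < e"
      by (intro bexI[of _ q]) auto
  qed
qed

subsection \<open>Averages over balls and the measure on the product\<close>

lemma continuous_r: "continuous_on A (r k)"
proof (rule continuous_onI)
  fix x e assume "0 < (e::real)"
  moreover have "dist (r k y) (r k x) \<le> dist y x" for y
    using r_lipschitz[of k x y] r_lipschitz[of k y x] by (auto simp: dist_real_def dist_commute abs_le_iff)
  ultimately show "\<exists>d>0. \<forall>y\<in>A. dist y x < d \<longrightarrow> dist (r k y) (r k x) \<le> e"
    by (meson order_less_imp_le order_trans)
qed

lemma r_measurable [measurable]: "r k \<in> borel_measurable borel"
  by (intro borel_measurable_continuous_onI continuous_r)

lemma dist_measurable [measurable]:
  "(\<lambda>z. dist (fst z) (snd z)) \<in> borel_measurable (borel \<Otimes>\<^sub>M borel :: ('a \<times> 'a) measure)"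
proof -
  have "(\<lambda>z :: 'a \<times> 'a. dist (fst z) (snd z)) \<in> borel_measurable borel"
    by (intro borel_measurable_continuous_onI continuous_intros)
  then show ?thesis
    using measurable_cong_sets[OF sets_borel_pair refl] by blast
qed

definition \<kappa> :: "nat \<Rightarrow> 'a \<Rightarrow> 'a measure" where
  "\<kappa> k x = uniform_measure m (cball x (r k x))"

lemma sets_\<kappa> [measurable_cong, simp]: "sets (\<kappa> k x) = sets borel"
  by (simp add: \<kappa>_def)

lemma emeasure_ball_nonzero: "emeasure m (cball x (r k x)) \<noteq> 0"
  using measure_ball_pos[of x k] by (simp add: emeasure_eq_measure)

lemma prob_space_\<kappa>: "prob_space (\<kappa> k x)"
  unfolding \<kappa>_def by (intro prob_space_uniform_measure emeasure_ball_nonzero) auto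

lemma AE_\<kappa>: "(\<And>u. dist x u \<le> r k x \<Longrightarrow> P u) \<Longrightarrow> AE u in \<kappa> k x. P u"
  unfolding \<kappa>_def by (intro AE_uniform_measureI) auto

definition w :: "nat \<Rightarrow> 'a \<Rightarrow> 'a \<Rightarrow> ennreal" where
  "w k u v = indicator (cball u (r k u)) v / emeasure m (cball u (r k u))"

lemma w_measurable [measurable]: "(\<lambda>z. w k (fst z) (snd z)) \<in> borel_measurable (borel \<Otimes>\<^sub>M borel)"
proof -
  define Q where "Q = {z \<in> space (borel \<Otimes>\<^sub>M borel :: ('a \<times> 'a) measure). dist (fst z) (snd z) \<le> r k (fst z)}"
  have Q [measurable]: "Q \<in> sets (borel \<Otimes>\<^sub>M borel)" unfolding Q_def by measurable
  then have "Q \<in> sets (borel \<Otimes>\<^sub>M m)" by (simp cong: sets_pair_measure_cong)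
  then have [measurable]: "(\<lambda>u. emeasure m (Pair u -` Q)) \<in> borel_measurable borel"
    by (rule measurable_emeasure_Pair)
  have "Pair u -` Q = cball u (r k u)" for u by (auto simp: Q_def space_pair_measure)
  then have eq: "(\<lambda>z. w k (fst z) (snd z)) = (\<lambda>z. indicator Q z / emeasure m (Pair (fst z) -` Q))"
    by (auto simp: w_def fun_eq_iff Q_def space_pair_measure indicator_def)
  show ?thesis unfolding eq by measurable
qed

lemma w_measurable' [measurable]: "w k u \<in> borel_measurable borel"
  unfolding w_def[abs_def] by measurable

lemma nn_integral_\<kappa>:
  assumes [measurable]: "\<psi> \<in> borel_measurable borel"
  shows "(\<integral>\<^sup>+ v. \<psi> v \<partial>\<kappa> k u) = (\<integral>\<^sup>+ v. w k u v * \<psi> v \<partial>m)"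
  unfolding \<kappa>_def uniform_measure_def w_def by (subst nn_integral_density) auto

lemma nn_integral_\<kappa>_le:
  assumes [measurable]: "\<psi> \<in> borel_measurable borel"
  shows "(\<integral>\<^sup>+ v. \<psi> v \<partial>\<kappa> k u) \<le> ennreal ((R ^ k) powr p) * (\<integral>\<^sup>+ v. \<psi> v \<partial>m)"
proof -
  have "w k u v \<le> ennreal ((R ^ k) powr p)" for v
  proof -
    have "1 / measure m (cball u (r k u)) \<le> 1 / \<theta> k"
      using \<theta>_le_measure \<theta>_pos measure_ball_pos by (intro divide_left_mono mult_pos_pos) auto
    also have "1 / \<theta> k = (R ^ k) powr p"
      using R by (simp add: \<theta>_def powr_divide)
    finally have "ennreal (1 / measure m (cball u (r k u))) \<le> ennreal ((R ^ k) powr p)"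
      by (rule ennreal_leI)
    then show ?thesis
      using measure_ball_pos[of u k]
      by (auto simp: w_def emeasure_eq_measure indicator_def divide_ennreal simp flip: ennreal_1)
  qed
  then show ?thesis
    unfolding nn_integral_\<kappa>[OF assms]
    by (subst nn_integral_cmult[symmetric]) (auto intro!: nn_integral_mono mult_right_mono)
qed

definition J :: "('a \<times> 'a \<Rightarrow> ennreal) \<Rightarrow> nat \<Rightarrow> 'a \<Rightarrow> ennreal" where
  "J \<psi> k u = (\<integral>\<^sup>+ v. \<psi> (u, v) \<partial>\<kappa> k u)"

lemma J_eq:
  assumes [measurable]: "\<psi> \<in> borel_measurable (borel \<Otimes>\<^sub>M borel)"
  shows "J \<psi> k u = (\<integral>\<^sup>+ v. w k u v * \<psi> (u, v) \<partial>m)"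
  unfolding J_def by (rule nn_integral_\<kappa>) measurable

lemma J_measurable [measurable]:
  assumes [measurable]: "\<psi> \<in> borel_measurable (borel \<Otimes>\<^sub>M borel)"
  shows "J \<psi> k \<in> borel_measurable borel"
proof -
  have "(\<lambda>z. w k (fst z) (snd z) * \<psi> z) \<in> borel_measurable (borel \<Otimes>\<^sub>M m)"
    by measurable
  from borel_measurable_nn_integral_fst[OF this] show ?thesis
    by (simp add: J_eq[OF assms, abs_def])
qed

definition N :: ennreal where "N = (\<Sum>k. \<integral>\<^sup>+ u. ennreal (R ^ k * r k u) \<partial>m)"

lemma N_le: "N \<le> ennreal (R / (R - 1) * S)"
  unfolding N_def
proof (rule suminf_le_const)
  fix n
  have "(\<Sum>k<n. \<integral>\<^sup>+ u. ennreal (R ^ k * r k u) \<partial>m) = (\<integral>\<^sup>+ u. ennreal (\<Sum>k<n. R ^ k * r k u) \<partial>m)"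
    using R by (subst nn_integral_sum[symmetric]) (auto simp: sum_ennreal)
  also have "\<dots> \<le> (\<integral>\<^sup>+ u. ennreal (R / (R - 1) * S) \<partial>m)"
  proof (intro nn_integral_mono ennreal_leI)
    fix u
    have "(\<Sum>k<n. R ^ k * r k u) \<le> (\<Sum>k\<le>n. R ^ k * r k u)"
      using R by (intro sum_mono2) auto
    with sum_r_le[where n = n and x = u] show "(\<Sum>k<n. R ^ k * r k u) \<le> R / (R - 1) * S" by linarith
  qed
  also have "\<dots> = ennreal (R / (R - 1) * S)"
    by (simp add: emeasure_space_1[simplified])
  finally show "(\<Sum>k<n. \<integral>\<^sup>+ u. ennreal (R ^ k * r k u) \<partial>m) \<le> ennreal (R / (R - 1) * S)" .
qed simp

lemma cball_r_0: "cball x (r 0 x) = UNIV"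
proof (rule ccontr)
  let ?A = "cball x (r 0 x)"
  assume "?A \<noteq> UNIV"
  then obtain y where y: "y \<notin> ?A" by blast
  have "measure m ?A = 1"
    using \<theta>_le_measure[of 0 x] prob_le_1[of ?A] by (simp add: \<theta>_def)
  then have "emeasure m (- ?A) = 0"
    using prob_compl[of ?A] unfolding Compl_eq_Diff_UNIV space_m emeasure_eq_measure by simp
  moreover have "0 < emeasure m (- ?A)"
  proof -
    have "\<forall>U. open U \<and> y \<in> U \<longrightarrow> 0 < emeasure m U"
      using support UNIV_I[of y] unfolding measure_support_def by blast
    moreover have "open (- ?A)" by (intro open_Compl closed_cball)
    ultimately show ?thesis using y by (meson ComplI)
  qed
  ultimately show False by simp
qed

lemma N_pos:
  assumes "x \<noteq> (y :: 'a)"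
  shows "0 < N"
proof -
  have "0 < r 0 u" for u
  proof (rule ccontr)
    assume "\<not> 0 < r 0 u"
    then have "r 0 u = 0" using r_nonneg[of 0 u] by linarith
    have "{u} = UNIV" using cball_r_0[of u] \<open>r 0 u = 0\<close> by simp
    have "x \<in> {u}" "y \<in> {u}" unfolding \<open>{u} = UNIV\<close> by (rule UNIV_I)+
    then have "x = u" "y = u" by simp_all
    with assms show False by blast
  qed
  note pos = this
  have "(\<integral>\<^sup>+ u. ennreal (R ^ 0 * r 0 u) \<partial>m) \<noteq> 0"
  proof
    assume "(\<integral>\<^sup>+ u. ennreal (R ^ 0 * r 0 u) \<partial>m) = 0"
    then have "AE u in m. ennreal (R ^ 0 * r 0 u) = 0"
      by (subst (asm) nn_integral_0_iff_AE) measurable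
    moreover have "ennreal (R ^ 0 * r 0 u) \<noteq> 0" for u
      using pos[of u] by (simp add: ennreal_eq_0_iff not_le)
    ultimately have "AE u in m. False" by simp
    then show False unfolding AE_False .
  qed
  moreover have "(\<integral>\<^sup>+ u. ennreal (R ^ 0 * r 0 u) \<partial>m) \<le> N"
    unfolding N_def using sum_le_suminf[of "\<lambda>k. \<integral>\<^sup>+ u. ennreal (R ^ k * r k u) \<partial>m" "{0}"] by simp
  ultimately show ?thesis by (metis le_zero_eq zero_less_iff_neq_zero)
qed

definition \<nu> :: "('a \<times> 'a) measure" where
  "\<nu> = density (m \<Otimes>\<^sub>M m) (\<lambda>z. (\<Sum>k. ennreal (R ^ k * r k (fst z)) * w k (fst z) (snd z)) / N)"

lemma sets_\<nu>: "sets \<nu> = sets borel"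
  unfolding \<nu>_def sets_density sets_borel_pair by (intro sets_pair_measure_cong) auto

lemma nn_integral_\<nu>:
  assumes [measurable]: "\<psi> \<in> borel_measurable (borel \<Otimes>\<^sub>M borel)"
  shows "(\<integral>\<^sup>+ z. \<psi> z \<partial>\<nu>) = (\<Sum>k. \<integral>\<^sup>+ u. ennreal (R ^ k * r k u) * J \<psi> k u \<partial>m) / N"
proof -
  have "(\<integral>\<^sup>+ z. \<psi> z \<partial>\<nu>) =
      (\<integral>\<^sup>+ z. (\<Sum>k. ennreal (R ^ k * r k (fst z)) * w k (fst z) (snd z)) / N * \<psi> z \<partial>(m \<Otimes>\<^sub>M m))"
    unfolding \<nu>_def by (intro nn_integral_density) measurable
  also have "\<dots> = (\<integral>\<^sup>+ z. (\<Sum>k. ennreal (R ^ k * r k (fst z)) * (w k (fst z) (snd z) * \<psi> z)) / N \<partial>(m \<Otimes>\<^sub>M m))"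
    by (intro nn_integral_cong) (simp add: divide_ennreal_def mult_ac flip: ennreal_suminf_multc)
  also have "\<dots> = (\<integral>\<^sup>+ z. (\<Sum>k. ennreal (R ^ k * r k (fst z)) * (w k (fst z) (snd z) * \<psi> z)) \<partial>(m \<Otimes>\<^sub>M m)) / N"
    by (intro nn_integral_divide) measurable
  also have "(\<integral>\<^sup>+ z. (\<Sum>k. ennreal (R ^ k * r k (fst z)) * (w k (fst z) (snd z) * \<psi> z)) \<partial>(m \<Otimes>\<^sub>M m)) =
      (\<Sum>k. \<integral>\<^sup>+ z. ennreal (R ^ k * r k (fst z)) * (w k (fst z) (snd z) * \<psi> z) \<partial>(m \<Otimes>\<^sub>M m))"
    by (intro nn_integral_suminf) measurable
  also have "\<dots> = (\<Sum>k. \<integral>\<^sup>+ u. ennreal (R ^ k * r k u) * J \<psi> k u \<partial>m)"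
  proof (intro suminf_cong)
    fix k
    have "(\<integral>\<^sup>+ z. ennreal (R ^ k * r k (fst z)) * (w k (fst z) (snd z) * \<psi> z) \<partial>(m \<Otimes>\<^sub>M m)) =
       (\<integral>\<^sup>+ u. \<integral>\<^sup>+ v. ennreal (R ^ k * r k u) * (w k u v * \<psi> (u, v)) \<partial>m \<partial>m)"
      by (subst nn_integral_fst[symmetric]) auto
    also have "\<dots> = (\<integral>\<^sup>+ u. ennreal (R ^ k * r k u) * J \<psi> k u \<partial>m)"
      by (intro nn_integral_cong) (auto simp: J_eq[OF assms] intro!: nn_integral_cmult)
    finally show "(\<integral>\<^sup>+ z. ennreal (R ^ k * r k (fst z)) * (w k (fst z) (snd z) * \<psi> z) \<partial>(m \<Otimes>\<^sub>M m)) =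
       (\<integral>\<^sup>+ u. ennreal (R ^ k * r k u) * J \<psi> k u \<partial>m)" .
  qed
  finally show ?thesis .
qed

lemma prob_space_\<nu>:
  assumes "x \<noteq> (y :: 'a)"
  shows "prob_space \<nu>"
proof
  have "J (\<lambda>_. 1) k u = 1" for k u
    using prob_space.emeasure_space_1[OF prob_space_\<kappa>[of k u]] by (simp add: J_def)
  then have "(\<integral>\<^sup>+ z. 1 \<partial>\<nu>) = N / N"
    using nn_integral_\<nu>[of "\<lambda>_. 1"] by (simp add: N_def)
  also have "\<dots> = 1"
  proof (rule ennreal_divide_self)
    show "N \<noteq> 0" using N_pos[OF assms] by simp
    show "N < \<top>" using N_le ennreal_less_top by (rule le_less_trans)
  qed
  finally show "emeasure \<nu> (space \<nu>) = 1" by simp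
qed

subsection \<open>Chaining\<close>

definition Z :: "real \<Rightarrow> nat \<Rightarrow> 'a \<Rightarrow> real" where
  "Z c n x = c * ((\<Sum>k<n. R ^ k * r k x) + (\<Sum>k<n. R ^ k) * r n x)"

lemma sum_R: "(\<Sum>k<n. R ^ k) = (R ^ n - 1) / (R - 1)"
  using R by (intro geometric_sum) auto

lemma Z_nonneg: "0 \<le> c \<Longrightarrow> 0 \<le> Z c n x"
  unfolding Z_def using R by (intro mult_nonneg_nonneg add_nonneg_nonneg sum_nonneg) auto

lemma Z_step:
  assumes c: "0 \<le> c" "d * (R - 1) \<le> c * (R - 2)" and u: "dist x u \<le> r (Suc n) x"
  shows "d * (R ^ n * r n u) + Z c n u \<le> Z c (Suc n) x"
proof -
  have "(d * R ^ n + c * (\<Sum>k<n. R ^ k)) * (R - 1) = R ^ n * (d * (R - 1)) + c * (R ^ n - 1)"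
    using R by (simp add: sum_R field_simps)
  also have "\<dots> \<le> R ^ n * (c * (R - 2)) + c * R ^ n"
    using R c by (intro add_mono mult_left_mono) auto
  also have "\<dots> = c * R ^ n * (R - 1)" by (simp add: algebra_simps)
  finally have coeff: "d * R ^ n + c * (\<Sum>k<n. R ^ k) \<le> c * R ^ n"
    using R by (simp add: mult_le_cancel_right)
  have "d * (R ^ n * r n u) + Z c n u = c * (\<Sum>k<n. R ^ k * r k u) + (d * R ^ n + c * (\<Sum>k<n. R ^ k)) * r n u"
    by (simp add: Z_def algebra_simps)
  also have "\<dots> \<le> c * (\<Sum>k<n. R ^ k * r k u) + c * R ^ n * r n u"
    by (intro add_left_mono mult_right_mono coeff) simp
  also have "\<dots> = c * (\<Sum>k<Suc n. R ^ k * r k u)"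
    by (simp add: algebra_simps)
  also have "\<dots> \<le> c * (\<Sum>k<Suc n. R ^ k * (r k x + r (Suc n) x))"
  proof (intro mult_left_mono sum_mono c)
    fix k
    show "r k u \<le> r k x + r (Suc n) x"
      using r_lipschitz[of k u x] u by (simp add: dist_commute)
  qed (use R in auto)
  also have "\<dots> = Z c (Suc n) x"
    unfolding Z_def by (simp only: distrib_left sum.distrib sum_distrib_right)
  finally show ?thesis .
qed

lemma Z_le:
  assumes "0 \<le> c"
  shows "Z c n x \<le> c * (R / (R - 1) * S)"
proof -
  have "R ^ n * 1 \<le> R ^ n * (R - 1)"
    using R by (intro mult_left_mono) auto
  then have "R ^ n - 1 \<le> R ^ n * (R - 1)" by linarith
  then have "(\<Sum>k<n. R ^ k) \<le> R ^ n"
    using R unfolding sum_R by (subst pos_divide_le_eq) auto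
  then have "Z c n x \<le> c * ((\<Sum>k<n. R ^ k * r k x) + R ^ n * r n x)"
    unfolding Z_def using assms by (intro mult_left_mono add_left_mono mult_right_mono) auto
  also have "\<dots> = c * (\<Sum>k\<le>n. R ^ k * r k x)"
    by (simp add: lessThan_Suc_atMost[symmetric])
  also have "\<dots> \<le> c * (R / (R - 1) * S)"
    by (intro mult_left_mono sum_r_le assms)
  finally show ?thesis .
qed

definition h :: "('a \<Rightarrow> real) \<Rightarrow> 'a \<times> 'a \<Rightarrow> ennreal" where
  "h f z = ennreal ((\<bar>f (fst z) - f (snd z)\<bar> / dist (fst z) (snd z)) powr p)"

lemma h_measurable [measurable]:
  assumes [measurable]: "f \<in> borel_measurable borel"
  shows "h f \<in> borel_measurable (borel \<Otimes>\<^sub>M borel)"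
  unfolding h_def[abs_def] by measurable

definition avg :: "('a \<Rightarrow> real) \<Rightarrow> nat \<Rightarrow> 'a \<Rightarrow> real" where
  "avg f k x = (\<integral>u. f u \<partial>\<kappa> k x)"

lemma avg_0: "avg f 0 x = avg f 0 y"
  by (simp add: avg_def \<kappa>_def cball_r_0)

context
  fixes f :: "'a \<Rightarrow> real" and B :: real
  assumes f_cont: "continuous_on UNIV f" and f_bound: "\<And>x. \<bar>f x\<bar> \<le> B"
begin

lemma f_measurable [measurable]: "f \<in> borel_measurable borel"
  by (intro borel_measurable_continuous_onI f_cont)

lemma integrable_f: "integrable (\<kappa> k x) f"
proof -
  interpret \<kappa>: prob_space "\<kappa> k x" by (rule prob_space_\<kappa>)
  show ?thesis by (rule \<kappa>.integrable_const_bound[of _ B]) (auto simp: f_bound)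
qed

lemma abs_avg_minus_le: "ennreal \<bar>avg f k x - a\<bar> \<le> (\<integral>\<^sup>+ u. ennreal \<bar>f u - a\<bar> \<partial>\<kappa> k x)"
proof -
  interpret \<kappa>: prob_space "\<kappa> k x" by (rule prob_space_\<kappa>)
  have "avg f k x - a = (\<integral>u. f u - a \<partial>\<kappa> k x)"
    unfolding avg_def using integrable_f by (simp add: \<kappa>.prob_space)
  then show ?thesis
    using integral_norm_bound_ennreal[of "\<kappa> k x" "\<lambda>u. f u - a"] integrable_f by simp
qed

lemma abs_minus_avg_le:
  assumes "0 < \<tau>"
  shows "ennreal \<bar>f u - avg f k u\<bar> \<le> ennreal (r k u * (1 / p * \<tau> powr (1 - p))) * J (h f) k u +
     ennreal (r k u * ((1 - 1 / p) * \<tau>))"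
proof -
  interpret \<kappa>: prob_space "\<kappa> k u" by (rule prob_space_\<kappa>)
  let ?a = "r k u * (1 / p * \<tau> powr (1 - p))" and ?b = "r k u * ((1 - 1 / p) * \<tau>)"
  have ab: "0 \<le> ?a" "0 \<le> ?b" using p assms by auto
  have "ennreal \<bar>f u - avg f k u\<bar> \<le> (\<integral>\<^sup>+ v. ennreal \<bar>f v - f u\<bar> \<partial>\<kappa> k u)"
    using abs_avg_minus_le[of k u "f u"] by (simp add: abs_minus_commute)
  also have "\<dots> \<le> (\<integral>\<^sup>+ v. ennreal ?a * h f (u, v) + ennreal ?b \<partial>\<kappa> k u)"
  proof (intro nn_integral_mono_AE AE_\<kappa>)
    fix v assume v: "dist u v \<le> r k u"
    define y where "y = \<bar>f u - f v\<bar> / dist u v"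
    have "\<bar>f v - f u\<bar> \<le> ?a * y powr p + ?b"
    proof -
      have "\<bar>f v - f u\<bar> = dist u v * y" by (auto simp: y_def abs_minus_commute)
      also have "\<dots> \<le> r k u * y" using v by (intro mult_right_mono) (auto simp: y_def)
      also have "\<dots> \<le> r k u * (1 / p * (y powr p * \<tau> powr (1 - p)) + (1 - 1 / p) * \<tau>)"
        using assms p by (intro mult_left_mono le_Young_powr) (auto simp: y_def)
      also have "\<dots> = ?a * y powr p + ?b" by (simp add: algebra_simps)
      finally show ?thesis .
    qed
    then have "ennreal \<bar>f v - f u\<bar> \<le> ennreal (?a * y powr p + ?b)" by (rule ennreal_leI)
    also have "\<dots> = ennreal ?a * ennreal (y powr p) + ennreal ?b"
      by (simp only: ennreal_plus ennreal_mult ab mult_nonneg_nonneg powr_ge_zero)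
    also have "ennreal (y powr p) = h f (u, v)" by (simp add: h_def y_def)
    finally show "ennreal \<bar>f v - f u\<bar> \<le> ennreal ?a * h f (u, v) + ennreal ?b" .
  qed
  also have "\<dots> = ennreal ?a * J (h f) k u + ennreal ?b"
    by (subst nn_integral_add) (auto simp: nn_integral_cmult J_def \<kappa>.emeasure_space_1)
  finally show ?thesis .
qed

lemma abs_avg_diff_le:
  assumes c: "0 \<le> c" "(1 - 1 / p) * (R - 1) \<le> c * (R - 2)" and \<tau>: "0 < \<tau>"
  shows "ennreal \<bar>avg f n x - avg f 0 x\<^sub>0\<bar> \<le>
    ennreal (R / p * \<tau> powr (1 - p)) * (\<Sum>k<n. \<integral>\<^sup>+ u. ennreal (R ^ k * r k u) * J (h f) k u \<partial>m) +
    ennreal (\<tau> * R * Z c n x)"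
proof (induction n arbitrary: x)
  case 0
  then show ?case by (simp add: avg_0[of f x x\<^sub>0])
next
  case (Suc n)
  let ?d = "1 - 1 / p"
  let ?I = "\<integral>\<^sup>+ u. ennreal (R ^ n * r n u) * J (h f) n u \<partial>m"
  let ?C = "ennreal (R / p * \<tau> powr (1 - p))"
  let ?\<Sigma> = "\<Sum>k<n. \<integral>\<^sup>+ u. ennreal (R ^ k * r k u) * J (h f) k u \<partial>m"
  define t where "t = \<tau> * R ^ Suc n"
  define e where "e = ennreal (1 / p * t powr (1 - p))"
  have t: "0 < t" using \<tau> R by (simp add: t_def)
  have d: "0 \<le> ?d" using p by simp
  interpret \<kappa>: prob_space "\<kappa> (Suc n) x" by (rule prob_space_\<kappa>)
  have "ennreal \<bar>avg f (Suc n) x - avg f 0 x\<^sub>0\<bar> \<le> (\<integral>\<^sup>+ u. ennreal \<bar>f u - avg f 0 x\<^sub>0\<bar> \<partial>\<kappa> (Suc n) x)"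
    by (rule abs_avg_minus_le)
  also have "\<dots> \<le> (\<integral>\<^sup>+ u. e * (ennreal (r n u) * J (h f) n u) + (?C * ?\<Sigma> + ennreal (\<tau> * R * Z c (Suc n) x)) \<partial>\<kappa> (Suc n) x)"
  proof (intro nn_integral_mono_AE AE_\<kappa>)
    fix u assume u: "dist x u \<le> r (Suc n) x"
    have "ennreal \<bar>f u - avg f 0 x\<^sub>0\<bar> \<le> ennreal \<bar>f u - avg f n u\<bar> + ennreal \<bar>avg f n u - avg f 0 x\<^sub>0\<bar>"
      by (subst ennreal_plus[symmetric]) (auto simp del: ennreal_plus intro!: ennreal_leI)
    also have "\<dots> \<le> (ennreal (r n u * (1 / p * t powr (1 - p))) * J (h f) n u + ennreal (r n u * (?d * t))) +
        (?C * ?\<Sigma> + ennreal (\<tau> * R * Z c n u))"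
      by (intro add_mono abs_minus_avg_le Suc.IH t)
    also have "\<dots> = e * (ennreal (r n u) * J (h f) n u) +
        (?C * ?\<Sigma> + (ennreal (r n u * (?d * t)) + ennreal (\<tau> * R * Z c n u)))"
    proof -
      have "ennreal (r n u * (1 / p * t powr (1 - p))) = ennreal (r n u) * e"
        unfolding e_def using p by (intro ennreal_mult) auto
      then show ?thesis by (simp only: add_ac mult_ac)
    qed
    also have "ennreal (r n u * (?d * t)) + ennreal (\<tau> * R * Z c n u) =
        ennreal (r n u * (?d * t) + \<tau> * R * Z c n u)"
      by (intro ennreal_plus[symmetric] mult_nonneg_nonneg Z_nonneg c d r_nonneg) (use t \<tau> R in auto)
    also have "r n u * (?d * t) + \<tau> * R * Z c n u = \<tau> * R * (?d * (R ^ n * r n u) + Z c n u)"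
      by (simp add: t_def algebra_simps)
    also have "\<dots> \<le> ennreal (\<tau> * R * Z c (Suc n) x)"
      using R \<tau> by (intro ennreal_leI mult_left_mono Z_step c u) auto
    finally show "ennreal \<bar>f u - avg f 0 x\<^sub>0\<bar> \<le> e * (ennreal (r n u) * J (h f) n u) +
        (?C * ?\<Sigma> + ennreal (\<tau> * R * Z c (Suc n) x))"
      by (simp add: add_mono)
  qed
  also have "\<dots> = e * (\<integral>\<^sup>+ u. ennreal (r n u) * J (h f) n u \<partial>\<kappa> (Suc n) x) + (?C * ?\<Sigma> + ennreal (\<tau> * R * Z c (Suc n) x))"
    by (subst nn_integral_add) (auto simp: nn_integral_cmult \<kappa>.emeasure_space_1)
  also have "e * (\<integral>\<^sup>+ u. ennreal (r n u) * J (h f) n u \<partial>\<kappa> (Suc n) x) \<le> ?C * ?I"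
  proof -
    have "e * (\<integral>\<^sup>+ u. ennreal (r n u) * J (h f) n u \<partial>\<kappa> (Suc n) x) \<le>
        e * (ennreal ((R ^ Suc n) powr p) * (\<integral>\<^sup>+ u. ennreal (r n u) * J (h f) n u \<partial>m))"
      by (intro mult_left_mono nn_integral_\<kappa>_le) auto
    also have "\<dots> = (e * ennreal ((R ^ Suc n) powr p)) * (\<integral>\<^sup>+ u. ennreal (r n u) * J (h f) n u \<partial>m)"
      by (simp add: mult.assoc)
    also have "e * ennreal ((R ^ Suc n) powr p) = ?C * ennreal (R ^ n)"
    proof -
      have "t powr (1 - p) * (R ^ Suc n) powr p = \<tau> powr (1 - p) * ((R ^ Suc n) powr (1 - p) * (R ^ Suc n) powr p)"
        unfolding t_def using \<tau> R by (simp only: powr_mult mult.assoc)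
      also have "(R ^ Suc n) powr (1 - p) * (R ^ Suc n) powr p = R ^ Suc n"
        using R by (simp add: powr_add[symmetric] del: power_Suc)
      finally have "1 / p * t powr (1 - p) * (R ^ Suc n) powr p = R / p * \<tau> powr (1 - p) * R ^ n"
        by simp
      then show ?thesis
        unfolding e_def using p R by (subst (1 2) ennreal_mult[symmetric]) auto
    qed
    also have "?C * ennreal (R ^ n) * (\<integral>\<^sup>+ u. ennreal (r n u) * J (h f) n u \<partial>m) = ?C * ?I"
      using R by (simp add: mult.assoc nn_integral_cmult[symmetric] ennreal_mult)
    finally show ?thesis .
  qed
  also have "?C * ?I + (?C * ?\<Sigma> + ennreal (\<tau> * R * Z c (Suc n) x)) =
      ?C * (\<Sum>k<Suc n. \<integral>\<^sup>+ u. ennreal (R ^ k * r k u) * J (h f) k u \<partial>m) + ennreal (\<tau> * R * Z c (Suc n) x)"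
    by (simp add: distrib_left add_ac)
  finally show ?case by (simp add: add_mono)
qed

lemma avg_tendsto: "(\<lambda>n. avg f n x) \<longlonglongrightarrow> f x"
proof (rule LIMSEQ_I)
  fix e :: real assume "0 < e"
  then have "0 < e / 2" by simp
  obtain d where d: "0 < d" "\<And>u. dist u x < d \<Longrightarrow> dist (f u) (f x) < e / 2"
    using f_cont \<open>0 < e / 2\<close> unfolding continuous_on_iff by (metis UNIV_I)
  have "\<forall>\<^sub>F n in sequentially. r n x < d"
    using r_tendsto_0 d(1) by (rule order_tendstoD)
  then obtain n0 where n0: "\<And>n. n \<ge> n0 \<Longrightarrow> r n x < d"
    by (auto simp: eventually_sequentially)
  have "norm (avg f n x - f x) < e" if "n \<ge> n0" for n
  proof -
    interpret \<kappa>: prob_space "\<kappa> n x" by (rule prob_space_\<kappa>)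
    have "ennreal \<bar>avg f n x - f x\<bar> \<le> (\<integral>\<^sup>+ u. ennreal \<bar>f u - f x\<bar> \<partial>\<kappa> n x)"
      by (rule abs_avg_minus_le)
    also have "\<dots> \<le> (\<integral>\<^sup>+ u. ennreal (e / 2) \<partial>\<kappa> n x)"
    proof (intro nn_integral_mono_AE AE_\<kappa> ennreal_leI)
      fix u assume "dist x u \<le> r n x"
      then show "\<bar>f u - f x\<bar> \<le> e / 2"
        using n0[OF that] d(2)[of u] by (simp add: dist_real_def dist_commute)
    qed
    also have "\<dots> = ennreal (e / 2)" by (simp add: \<kappa>.emeasure_space_1)
    finally show ?thesis using \<open>0 < e\<close> by simp
  qed
  then show "\<exists>n0. \<forall>n\<ge>n0. norm (avg f n x - f x) < e" by blast
qed

lemma abs_diff_avg_le: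
  assumes c: "0 \<le> c" "(1 - 1 / p) * (R - 1) \<le> c * (R - 2)" and \<tau>: "0 < \<tau>" and N: "0 < N"
  shows "ennreal \<bar>f x - avg f 0 x\<^sub>0\<bar> \<le>
    ennreal (R * (R / (R - 1) * S)) *
     (ennreal (1 / p * \<tau> powr (1 - p)) * (\<integral>\<^sup>+ z. h f z \<partial>\<nu>) + ennreal (c * \<tau>))"
proof -
  define M where "M = R / (R - 1) * S"
  have M: "0 \<le> M" using R S by (simp add: M_def)
  let ?H = "\<integral>\<^sup>+ z. h f z \<partial>\<nu>"
  have N_top: "N < \<top>" using N_le by (rule le_less_trans) simp
  have sum: "(\<Sum>k. \<integral>\<^sup>+ u. ennreal (R ^ k * r k u) * J (h f) k u \<partial>m) = N * ?H"
    using N N_top by (subst nn_integral_\<nu>) (auto simp: ennreal_times_divide ennreal_mult_divide_eq mult.commute[of N])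
  have "ennreal \<bar>avg f n x - avg f 0 x\<^sub>0\<bar> \<le>
      ennreal (R / p * \<tau> powr (1 - p)) * (ennreal M * ?H) + ennreal (\<tau> * R * (c * M))" for n
  proof -
    have "(\<Sum>k<n. \<integral>\<^sup>+ u. ennreal (R ^ k * r k u) * J (h f) k u \<partial>m) \<le> N * ?H"
      unfolding sum[symmetric] by (intro sum_le_suminf) auto
    also have "\<dots> \<le> ennreal M * ?H"
      using N_le by (intro mult_right_mono) (auto simp: M_def)
    finally have "(\<Sum>k<n. \<integral>\<^sup>+ u. ennreal (R ^ k * r k u) * J (h f) k u \<partial>m) \<le> ennreal M * ?H" .
    moreover have "ennreal (\<tau> * R * Z c n x) \<le> ennreal (\<tau> * R * (c * M))"
      unfolding M_def using \<tau> R by (intro ennreal_leI mult_left_mono Z_le c) auto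
    ultimately show ?thesis
      using abs_avg_diff_le[OF c \<tau>, of n x x\<^sub>0] by (meson add_mono mult_left_mono order_trans zero_le)
  qed
  moreover have "(\<lambda>n. ennreal \<bar>avg f n x - avg f 0 x\<^sub>0\<bar>) \<longlonglongrightarrow> ennreal \<bar>f x - avg f 0 x\<^sub>0\<bar>"
    by (intro tendsto_intros avg_tendsto)
  ultimately have "ennreal \<bar>f x - avg f 0 x\<^sub>0\<bar> \<le>
      ennreal (R / p * \<tau> powr (1 - p)) * (ennreal M * ?H) + ennreal (\<tau> * R * (c * M))"
    by (intro LIMSEQ_le_const2) blast+
  also have "\<dots> = ennreal (R * M) * (ennreal (1 / p * \<tau> powr (1 - p)) * ?H + ennreal (c * \<tau>))"
  proof -
    have "ennreal (R / p * \<tau> powr (1 - p)) * ennreal M = ennreal (R * M) * ennreal (1 / p * \<tau> powr (1 - p))"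
      using R p M by (subst (1 2) ennreal_mult[symmetric]) (auto simp: mult_ac)
    moreover have "ennreal (\<tau> * R * (c * M)) = ennreal (R * M) * ennreal (c * \<tau>)"
      using R c \<tau> M by (subst ennreal_mult[symmetric]) (auto simp: mult_ac)
    ultimately show ?thesis by (simp add: distrib_left mult.assoc[symmetric])
  qed
  finally show ?thesis by (simp add: M_def)
qed

end

lemma S_pos:
  assumes "x \<noteq> (y :: 'a)"
  shows "0 < S"
proof -
  have "0 < dist x y" using assms by simp
  also have "\<dots> \<le> D" by (rule dist_le_D)
  also have "\<dots> \<le> S" by (rule le_S_if_le_ediam) (simp_all add: D_nonneg ediam_eq)
  finally show ?thesis .
qed

lemma oscillation_le:
  fixes f :: "'a \<Rightarrow> real" and K :: real
  assumes c: "0 \<le> c" "(1 - 1 / p) * (R - 1) \<le> c * (R - 2)" and K: "0 < K"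
    and \<tau>: "\<And>H. 0 < H \<Longrightarrow> \<exists>\<tau>>0. R * (R / (R - 1)) * (1 / p * \<tau> powr (1 - p) * H + c * \<tau>) \<le> K * H powr (1 / p)"
    and f: "continuous_on UNIV f"
  shows "ennreal (\<bar>f s - f t\<bar> powr p) \<le> ennreal ((2 * (K * S)) powr p) * (\<integral>\<^sup>+ z. h f z \<partial>\<nu>)"
proof (cases "s = t")
  case False
  note S_pos = S_pos[OF False]
  define B where "B = max \<bar>f s\<bar> \<bar>f t\<bar>"
  define g where "g x = max (- B) (min B (f x))" for x
  have g_cont: "continuous_on UNIV g" unfolding g_def[abs_def] by (intro continuous_intros f)
  have "0 \<le> B" by (simp add: B_def max_def)
  then have g_bound: "\<bar>g x\<bar> \<le> B" for x by (auto simp: g_def)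
  have g_eq: "g s = f s" "g t = f t" by (auto simp: g_def B_def)
  have "h g z \<le> h f z" for z
    unfolding h_def using p
    by (intro ennreal_leI powr_mono2 divide_right_mono) (auto simp: g_def)
  then have hg: "(\<integral>\<^sup>+ z. h g z \<partial>\<nu>) \<le> (\<integral>\<^sup>+ z. h f z \<partial>\<nu>)"
    by (intro nn_integral_mono)
  show ?thesis
  proof (cases "(\<integral>\<^sup>+ z. h f z \<partial>\<nu>) = \<top>")
    case True
    then show ?thesis using K S_pos p by (simp add: ennreal_mult_top)
  next
    case False
    then obtain H where H: "0 \<le> H" "(\<integral>\<^sup>+ z. h f z \<partial>\<nu>) = ennreal H"
      by (metis ennreal_cases)
    have bound: "\<bar>f s - f t\<bar> powr p \<le> (2 * (K * S)) powr p * H'" if H': "H < H'" for H'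
    proof -
      have "0 < H'" using H' H by simp
      from \<tau>[OF this] obtain t0 where t0: "0 < t0"
        "R * (R / (R - 1)) * (1 / p * t0 powr (1 - p) * H' + c * t0) \<le> K * H' powr (1 / p)" by blast
      have *: "\<bar>g x - avg g 0 s\<bar> \<le> K * S * H' powr (1 / p)" for x
      proof -
        have "ennreal \<bar>g x - avg g 0 s\<bar> \<le> ennreal (R * (R / (R - 1) * S)) *
            (ennreal (1 / p * t0 powr (1 - p)) * (\<integral>\<^sup>+ z. h g z \<partial>\<nu>) + ennreal (c * t0))"
          by (rule abs_diff_avg_le[OF g_cont g_bound c t0(1) N_pos[OF \<open>s \<noteq> t\<close>]])
        also have "\<dots> \<le> ennreal (R * (R / (R - 1) * S)) *
            (ennreal (1 / p * t0 powr (1 - p)) * ennreal H' + ennreal (c * t0))"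
          using hg H H' by (intro mult_left_mono add_right_mono) (auto intro: order_trans ennreal_leI)
        also have "\<dots> = ennreal (R * (R / (R - 1) * S) * (1 / p * t0 powr (1 - p) * H' + c * t0))"
          using p \<open>0 < H'\<close> t0(1) c R S
          by (subst ennreal_mult[symmetric], simp, simp, subst ennreal_plus[symmetric], simp, simp,
              subst ennreal_mult[symmetric]) auto
        finally have "\<bar>g x - avg g 0 s\<bar> \<le> R * (R / (R - 1) * S) * (1 / p * t0 powr (1 - p) * H' + c * t0)"
          using p \<open>0 < H'\<close> t0(1) c R S by (subst (asm) ennreal_le_iff) auto
        also have "\<dots> = S * (R * (R / (R - 1)) * (1 / p * t0 powr (1 - p) * H' + c * t0))"
          by (simp add: mult_ac)
        also have "\<dots> \<le> S * (K * H' powr (1 / p))"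
          by (intro mult_left_mono t0 S)
        finally show ?thesis by (simp add: mult_ac)
      qed
      have "\<bar>f s - f t\<bar> \<le> 2 * (K * S) * H' powr (1 / p)"
        using *[of s] *[of t] unfolding g_eq by linarith
      then have "\<bar>f s - f t\<bar> powr p \<le> (2 * (K * S) * H' powr (1 / p)) powr p"
        using p by (intro powr_mono2) auto
      also have "\<dots> = (2 * (K * S)) powr p * H'"
        using p \<open>0 < H'\<close> by (simp add: powr_mult powr_powr)
      finally show ?thesis .
    qed
    have "\<bar>f s - f t\<bar> powr p \<le> (2 * (K * S)) powr p * H"
    proof (rule field_le_epsilon)
      fix e :: real assume "0 < e"
      define C where "C = (2 * (K * S)) powr p"
      have "0 < C" using K S_pos by (simp add: C_def)
      with bound[of "H + e / C"] \<open>0 < e\<close> show "\<bar>f s - f t\<bar> powr p \<le> (2 * (K * S)) powr p * H + e"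
        by (simp add: distrib_left flip: C_def)
    qed
    then show ?thesis by (simp add: H ennreal_leI flip: ennreal_mult)
  qed
qed (use p in simp)

end

theorem proposition2p1:
  fixes m :: "'a::metric_space measure" and p :: real
  assumes "prob_space m" and "sets m = sets borel"
    and "measure_support m = UNIV"
    and "p \<ge> 1"
    and "majorizing_sup p m < \<infinity>"
  shows "\<exists>\<nu> :: ('a \<times> 'a) measure. prob_space \<nu> \<and> sets \<nu> = sets borel \<and>
    (\<forall>f :: 'a \<Rightarrow> real. continuous_on UNIV f \<longrightarrow>
      (SUP s. SUP t. ennreal (\<bar>f s - f t\<bar> powr p))
        \<le> ennreal ((2 * K_const p (enn2real (majorizing_sup p m))) powr p) *
          (\<integral>\<^sup>+ (u, v). ennreal ((\<bar>f u - f v\<bar> / dist u v) powr p) \<partial>\<nu>))"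
proof (cases "\<exists>x y :: 'a. x \<noteq> y")
  case True
  then obtain x y :: 'a where xy: "x \<noteq> y" by blast
  define S where "S = enn2real (majorizing_sup p m)"
  define K where "K = 2 * ((3 * p - 1) / p) * conj_factor p"
  have K: "0 < K" using \<open>p \<ge> 1\<close> conj_factor_pos[of p] by (simp add: K_def)
  obtain R c where R: "2 \<le> R" and c: "0 \<le> c" "(1 - 1 / p) * (R - 1) \<le> c * (R - 2)"
    and \<tau>: "\<And>H. 0 < H \<Longrightarrow> \<exists>\<tau>>0. R * (R / (R - 1)) * (1 / p * \<tau> powr (1 - p) * H + c * \<tau>) \<le> K * H powr (1 / p)"
    using chaining_parameters[OF \<open>p \<ge> 1\<close>] unfolding K_def by blast
  interpret prob_space m by fact
  interpret majorizing_chain m p R S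
    using assms R by unfold_locales (simp_all add: S_def)
  show ?thesis
  proof (intro exI[of _ \<nu>] conjI allI impI SUP_least)
    show "prob_space \<nu>" by (rule prob_space_\<nu>[OF xy])
    show "sets \<nu> = sets borel" by (rule sets_\<nu>)
    fix f :: "'a \<Rightarrow> real" and s t :: 'a assume "continuous_on UNIV f"
    note osc = oscillation_le[OF c K \<tau> this, of s t]
    have "K_const p S = K * S" by (simp add: K_const_def K_def)
    with osc show "ennreal (\<bar>f s - f t\<bar> powr p) \<le> ennreal ((2 * K_const p (enn2real (majorizing_sup p m))) powr p) *
          (\<integral>\<^sup>+ (u, v). ennreal ((\<bar>f u - f v\<bar> / dist u v) powr p) \<partial>\<nu>)"
      by (simp add: h_def case_prod_unfold flip: S_def)
  qed
next
  case False
  then have "\<bar>f s - f t\<bar> powr p = 0" for f :: "'a \<Rightarrow> real" and s t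
    by (metis abs_zero diff_self powr_0)
  then have "(SUP s. SUP t. ennreal (\<bar>f s - f t\<bar> powr p)) = 0" for f :: "'a \<Rightarrow> real"
    by (simp only: ennreal_0 SUP_const[OF UNIV_not_empty])
  then show ?thesis
    by (intro exI[of _ "return borel (undefined, undefined)"]) (simp add: prob_space_return)
qed

end
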